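(* Let $\Sigma_r=\{0,1,-,+,\cdot\}$ (constants $0,1$, unary minus $-$, binary $+$ and $\cdot$). The term rewriting system $D_1$ obtained by orienting the following twelve equations from left to right is ground-complete: [R1] $x+0=x$; [R2] $0+x=x$; [R3] $x+(y+z)=(x+y)+z$; [R4] $x\cdot 0=0$; [R5] $x\cdot 1=x$; [R6] $x\cdot(y+z)=(x\cdot y)+(x\cdot z)$; [R7] $-0=0$; [R8] $(-1)+1=0$; [R9] $(-(x+1))+1=-x$; [R10] $-(-x)=x$; [R11] $x+(-y)=-((-x)+y)$; [R12] $x\cdot(-y)=-(x\cdot y)$.
   Context: Each equation is read as a rewrite rule from left to right, where $x,y,z$ are variables. A term rewriting system is ground-complete if it is strongly terminating (no infinite rewrite sequences) and ground-confluent (confluent on closed terms), so that every closed term has a unique normal form. In this paper, $D_1$ is intended as a specification of the ring of integers with normal forms $0$, the positive numerals $1$ and $t+1$ ($t$ a positive numeral), and $-t$ for $t$ a positive numeral. *)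

theory Defs
  imports Main
begin

datatype tm =
    Var nat
  | Zero ("\<zero>")
  | One ("\<one>")
  | Neg tm ("\<ominus> _" [81] 80)
  | Plus tm tm (infixl "\<oplus>" 65)
  | Times tm tm (infixl "\<odot>" 70)

fun vars :: "tm \<Rightarrow> nat set" where
  "vars (Var v) = {v}"
| "vars \<zero> = {}"
| "vars \<one> = {}"
| "vars (\<ominus> t) = vars t"
| "vars (s \<oplus> t) = vars s \<union> vars t"
| "vars (s \<odot> t) = vars s \<union> vars t"

definition closed_tm :: "tm \<Rightarrow> bool" where
  "closed_tm t \<longleftrightarrow> vars t = {}"

fun subst :: "(nat \<Rightarrow> tm) \<Rightarrow> tm \<Rightarrow> tm" where
  "subst \<sigma> (Var v) = \<sigma> v"
| "subst \<sigma> \<zero> = \<zero>"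
| "subst \<sigma> \<one> = \<one>"
| "subst \<sigma> (\<ominus> t) = \<ominus> (subst \<sigma> t)"
| "subst \<sigma> (s \<oplus> t) = subst \<sigma> s \<oplus> subst \<sigma> t"
| "subst \<sigma> (s \<odot> t) = subst \<sigma> s \<odot> subst \<sigma> t"

type_synonym trs = "(tm \<times> tm) set"

inductive_set rstep :: "trs \<Rightarrow> (tm \<times> tm) set" for R :: trs where
  rule: "(l, r) \<in> R \<Longrightarrow> (subst \<sigma> l, subst \<sigma> r) \<in> rstep R"
| neg: "(s, s') \<in> rstep R \<Longrightarrow> (\<ominus> s, \<ominus> s') \<in> rstep R"
| plus_left: "(s, s') \<in> rstep R \<Longrightarrow> (s \<oplus> t, s' \<oplus> t) \<in> rstep R"
| plus_right: "(t, t') \<in> rstep R \<Longrightarrow> (s \<oplus> t, s \<oplus> t') \<in> rstep R"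
| times_left: "(s, s') \<in> rstep R \<Longrightarrow> (s \<odot> t, s' \<odot> t) \<in> rstep R"
| times_right: "(t, t') \<in> rstep R \<Longrightarrow> (s \<odot> t, s \<odot> t') \<in> rstep R"

text \<open>Termination is required on all terms, closed or open; confluence only on closed ones.\<close>

definition strongly_terminating :: "trs \<Rightarrow> bool" where
  "strongly_terminating R \<longleftrightarrow> \<not> (\<exists>f :: nat \<Rightarrow> tm. \<forall>i. (f i, f (Suc i)) \<in> rstep R)"

definition ground_confluent :: "trs \<Rightarrow> bool" where
  "ground_confluent R \<longleftrightarrow>
    (\<forall>s t u. closed_tm s \<longrightarrow> closed_tm t \<longrightarrow> closed_tm u \<longrightarrow>
      (s, t) \<in> (rstep R)\<^sup>* \<longrightarrow> (s, u) \<in> (rstep R)\<^sup>* \<longrightarrow>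
      (\<exists>v. closed_tm v \<and> (t, v) \<in> (rstep R)\<^sup>* \<and> (u, v) \<in> (rstep R)\<^sup>*))"

definition ground_complete :: "trs \<Rightarrow> bool" where
  "ground_complete R \<longleftrightarrow> strongly_terminating R \<and> ground_confluent R"

definition D1 :: trs where
  "D1 = (let x = Var 0; y = Var 1; z = Var 2 in
   {(x \<oplus> \<zero>, x),
    (\<zero> \<oplus> x, x),
    (x \<oplus> (y \<oplus> z), (x \<oplus> y) \<oplus> z),
    (x \<odot> \<zero>, \<zero>),
    (x \<odot> \<one>, x),
    (x \<odot> (y \<oplus> z), (x \<odot> y) \<oplus> (x \<odot> z)),
    (\<ominus> \<zero>, \<zero>),
    ((\<ominus> \<one>) \<oplus> \<one>, \<zero>),
    ((\<ominus> (x \<oplus> \<one>)) \<oplus> \<one>, \<ominus> x),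
    (\<ominus> (\<ominus> x), x),
    (x \<oplus> (\<ominus> y), \<ominus> ((\<ominus> x) \<oplus> y)),
    (x \<odot> (\<ominus> y), \<ominus> (x \<odot> y))})"

end

theory Submission
  imports Defs
begin

text \<open>
  Termination: the polynomial interpretation
  \<open>0 \<mapsto> 2\<close>, \<open>1 \<mapsto> 2\<close>, \<open>-x \<mapsto> x + 1\<close>, \<open>x + y \<mapsto> x + 3 y + 1\<close>, \<open>x \<cdot> y \<mapsto> x y\<close> over the naturals
  at least 2 is strictly monotone and strictly decreases along every rule. The factor 3 pays
  for the second minus sign that R11 creates, and the bound 2 makes R6 and R12 strict.

  Ground confluence: every rule is an identity of the integers, and an irreducible closed term
  is a canonical numeral. Hence a closed term can only be normalised to the numeral
  of its integer value.
\<close>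

fun weight :: "tm \<Rightarrow> nat" where
  "weight (Var v) = 2"
| "weight \<zero> = 2"
| "weight \<one> = 2"
| "weight (\<ominus> t) = weight t + 1"
| "weight (s \<oplus> t) = weight s + 3 * weight t + 1"
| "weight (s \<odot> t) = weight s * weight t"

lemma weight_ge_2: "weight t \<ge> 2"
proof (induction t)
  case (Times s t)
  then have "2 * 1 \<le> weight s * weight t" by (intro mult_le_mono) auto
  then show ?case by simp
qed auto

lemma weight_pos [simp]: "weight t > 0"
  using weight_ge_2[of t] by linarith

lemma weight_D1_rule:
  assumes "(l, r) \<in> D1"
  shows "weight (subst \<sigma> r) < weight (subst \<sigma> l)"
  \<comment> \<open>Only variables 0, 1, 2 occur in the rules. R4, R6 and R12 all reduce to
    \<open>weight (\<sigma> 0) > 1\<close>.\<close>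
  using assms weight_ge_2[of "\<sigma> 0"] weight_ge_2[of "\<sigma> 1"] weight_ge_2[of "\<sigma> 2"]
  by (auto simp: D1_def Let_def algebra_simps)

lemma weight_rstep_D1:
  assumes "(s, t) \<in> rstep D1"
  shows "weight t < weight s"
  using assms by induction (simp_all add: weight_D1_rule)

lemma strongly_terminating_D1: "strongly_terminating D1"
  unfolding strongly_terminating_def
proof
  assume "\<exists>f :: nat \<Rightarrow> tm. \<forall>i. (f i, f (Suc i)) \<in> rstep D1"
  then obtain f :: "nat \<Rightarrow> tm" where "\<forall>i. (f (Suc i), f i) \<in> measure weight"
    using weight_rstep_D1 by fastforce
  then show False
    using wf_measure[of weight] unfolding wf_iff_no_infinite_down_chain by blast
qed

text \<open>Variables get the junk value \<open>0\<close>; only closed terms are evaluated below.\<close>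

fun int_value :: "tm \<Rightarrow> int" where
  "int_value (Var v) = 0"
| "int_value \<zero> = 0"
| "int_value \<one> = 1"
| "int_value (\<ominus> t) = - int_value t"
| "int_value (s \<oplus> t) = int_value s + int_value t"
| "int_value (s \<odot> t) = int_value s * int_value t"

text \<open>Evaluation respects contexts, and every rule is a ring identity that holds for any
  values of its variables.\<close>

lemma int_value_rstep_D1:
  assumes "(s, t) \<in> rstep D1"
  shows "int_value t = int_value s"
  using assms
  by induction (auto simp: D1_def Let_def algebra_simps)

lemma vars_rstep_D1:
  assumes "(s, t) \<in> rstep D1"
  shows "vars t \<subseteq> vars s"
  using assms by induction (auto simp: D1_def Let_def)

lemma closed_rsteps_D1:
  assumes "(s, t) \<in> (rstep D1)\<^sup>*" and "closed_tm s"
  shows "closed_tm t"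
  using assms by induction (auto simp: closed_tm_def dest: vars_rstep_D1)

lemma int_value_rsteps_D1:
  assumes "(s, t) \<in> (rstep D1)\<^sup>*"
  shows "int_value t = int_value s"
  using assms by induction (simp_all add: int_value_rstep_D1)

text \<open>Frees later redex arguments from substitutions. Item \<open>i\<close> is rule
  R\<open>i\<close>.\<close>

lemma D1_steps:
  "(x \<oplus> \<zero>, x) \<in> rstep D1"
  "(\<zero> \<oplus> x, x) \<in> rstep D1"
  "(x \<oplus> (y \<oplus> z), (x \<oplus> y) \<oplus> z) \<in> rstep D1"
  "(x \<odot> \<zero>, \<zero>) \<in> rstep D1"
  "(x \<odot> \<one>, x) \<in> rstep D1"
  "(x \<odot> (y \<oplus> z), (x \<odot> y) \<oplus> (x \<odot> z)) \<in> rstep D1"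
  "(\<ominus> \<zero>, \<zero>) \<in> rstep D1"
  "((\<ominus> \<one>) \<oplus> \<one>, \<zero>) \<in> rstep D1"
  "((\<ominus> (x \<oplus> \<one>)) \<oplus> \<one>, \<ominus> x) \<in> rstep D1"
  "(\<ominus> (\<ominus> x), x) \<in> rstep D1"
  "(x \<oplus> (\<ominus> y), \<ominus> ((\<ominus> x) \<oplus> y)) \<in> rstep D1"
  "(x \<odot> (\<ominus> y), \<ominus> (x \<odot> y)) \<in> rstep D1"
proof -
  have step: "(s, t) \<in> rstep D1"
    if "(l, r) \<in> D1" "subst (\<lambda>n. if n = 0 then x else if n = 1 then y else z) l = s"
      "subst (\<lambda>n. if n = 0 then x else if n = 1 then y else z) r = t" for l r s t
    using rstep.rule[OF that(1)] that(2,3) by metis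
  let ?x = "Var 0" and ?y = "Var 1" and ?z = "Var 2"
  show "(x \<oplus> \<zero>, x) \<in> rstep D1"
    by (rule step[of "?x \<oplus> \<zero>" ?x]) (simp_all add: D1_def Let_def)
  show "(\<zero> \<oplus> x, x) \<in> rstep D1"
    by (rule step[of "\<zero> \<oplus> ?x" ?x]) (simp_all add: D1_def Let_def)
  show "(x \<oplus> (y \<oplus> z), (x \<oplus> y) \<oplus> z) \<in> rstep D1"
    by (rule step[of "?x \<oplus> (?y \<oplus> ?z)" "(?x \<oplus> ?y) \<oplus> ?z"]) (simp_all add: D1_def Let_def)
  show "(x \<odot> \<zero>, \<zero>) \<in> rstep D1"
    by (rule step[of "?x \<odot> \<zero>" "\<zero>"]) (simp_all add: D1_def Let_def)
  show "(x \<odot> \<one>, x) \<in> rstep D1"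
    by (rule step[of "?x \<odot> \<one>" ?x]) (simp_all add: D1_def Let_def)
  show "(x \<odot> (y \<oplus> z), (x \<odot> y) \<oplus> (x \<odot> z)) \<in> rstep D1"
    by (rule step[of "?x \<odot> (?y \<oplus> ?z)" "(?x \<odot> ?y) \<oplus> (?x \<odot> ?z)"])
      (simp_all add: D1_def Let_def)
  show "(\<ominus> \<zero>, \<zero>) \<in> rstep D1"
    by (rule step[of "\<ominus> \<zero>" "\<zero>"]) (simp_all add: D1_def Let_def)
  show "((\<ominus> \<one>) \<oplus> \<one>, \<zero>) \<in> rstep D1"
    by (rule step[of "(\<ominus> \<one>) \<oplus> \<one>" "\<zero>"]) (simp_all add: D1_def Let_def)
  show "((\<ominus> (x \<oplus> \<one>)) \<oplus> \<one>, \<ominus> x) \<in> rstep D1"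
    by (rule step[of "(\<ominus> (?x \<oplus> \<one>)) \<oplus> \<one>" "\<ominus> ?x"]) (simp_all add: D1_def Let_def)
  show "(\<ominus> (\<ominus> x), x) \<in> rstep D1"
    by (rule step[of "\<ominus> (\<ominus> ?x)" ?x]) (simp_all add: D1_def Let_def)
  show "(x \<oplus> (\<ominus> y), \<ominus> ((\<ominus> x) \<oplus> y)) \<in> rstep D1"
    by (rule step[of "?x \<oplus> (\<ominus> ?y)" "\<ominus> ((\<ominus> ?x) \<oplus> ?y)"]) (simp_all add: D1_def Let_def)
  show "(x \<odot> (\<ominus> y), \<ominus> (x \<odot> y)) \<in> rstep D1"
    by (rule step[of "?x \<odot> (\<ominus> ?y)" "\<ominus> (?x \<odot> ?y)"]) (simp_all add: D1_def Let_def)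
qed

text \<open>Indices are shifted by one: \<open>numeral_tm n\<close> denotes \<open>n + 1\<close>.\<close>

fun numeral_tm :: "nat \<Rightarrow> tm" where
  "numeral_tm 0 = \<one>"
| "numeral_tm (Suc n) = numeral_tm n \<oplus> \<one>"

lemma int_value_numeral_tm [simp]: "int_value (numeral_tm n) = int n + 1"
  by (induction n) auto

text \<open>The intended normal forms. Numerals start at 1, so there is no negated zero and each
  integer has exactly one representative.\<close>

inductive canonical :: "tm \<Rightarrow> bool" where
  zero: "canonical \<zero>"
| pos: "canonical (numeral_tm n)"
| neg: "canonical (\<ominus> (numeral_tm n))"

text \<open>The sign of the value determines the shape, and its absolute value the index of the
  numeral.\<close>

lemma canonical_eqI:
  assumes "canonical s" "canonical t" "int_value s = int_value t"
  shows "s = t"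
  using assms by (auto elim!: canonical.cases)

text \<open>Steps lift through contexts, so the immediate subterms are irreducible, hence canonical
  by induction. Any combination of them that is not canonical is a redex at the root.\<close>

lemma irreducible_closed_canonical:
  assumes "closed_tm t" and "\<nexists>u. (t, u) \<in> rstep D1"
  shows "canonical t"
  using assms
proof (induction t)
  case (Var v)
  then show ?case by (simp add: closed_tm_def)
next
  case Zero
  show ?case by (rule canonical.zero)
next
  case One
  show ?case using canonical.pos[of 0] by simp
next
  case (Neg t)
  then have "canonical t"
    using rstep.neg[of t _ D1] by (auto simp: closed_tm_def)
  then show ?case
  proof cases
    case zero
    with Neg.prems(2) D1_steps(7) show ?thesis by blast
  next
    case (pos n)
    then show ?thesis by (simp add: canonical.neg)
  next
    case (neg n)
    with Neg.prems(2) D1_steps(10) show ?thesis by blast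
  qed
next
  case (Plus s t)
  then have s: "canonical s" and t: "canonical t"
    using rstep.plus_left[of s _ D1 t] rstep.plus_right[of t _ D1 s]
    by (auto simp: closed_tm_def)
  \<comment> \<open>Any other canonical right summand gives a redex: zero by R1, a numeral above 1
    by R3, a negative one by R11.\<close>
  have "t = \<one>"
    using t
  proof cases
    case (pos n)
    with Plus.prems(2) D1_steps(3) show ?thesis by (cases n) auto
  qed (use Plus.prems(2) D1_steps(1,11) in blast)+
  show ?case
    using s
  proof cases
    case zero
    with Plus.prems(2) D1_steps(2) show ?thesis by blast
  next
    case (pos n)
    with \<open>t = \<one>\<close> show ?thesis using canonical.pos[of "Suc n"] by simp
  next
    case (neg n)
    \<comment> \<open>R8 fires for minus one (\<open>n = 0\<close>), R9 for all smaller
      values.\<close>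
    with \<open>t = \<one>\<close> Plus.prems(2) D1_steps(8,9) show ?thesis by (cases n) auto
  qed
next
  case (Times s t)
  then have "canonical t"
    using rstep.times_right[of t _ D1 s] by (auto simp: closed_tm_def)
  \<comment> \<open>Every canonical right factor makes a redex: zero by R4, one by R5, a larger
    numeral by R6 with last summand \<open>\<one>\<close>, a negative one by R12. So no closed
    product is irreducible.\<close>
  then show ?case
  proof cases
    case (pos n)
    with Times.prems(2) D1_steps(5)[of s] D1_steps(6)[of s _ "\<one>"] show ?thesis
      by (cases n) auto
  qed (use Times.prems(2) D1_steps(4,12) in blast)+
qed

lemma closed_normalises_to_canonical:
  assumes "closed_tm s"
  shows "\<exists>t. (s, t) \<in> (rstep D1)\<^sup>* \<and> canonical t"
  using assms
proof (induction "weight s" arbitrary: s rule: less_induct)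
  case less
  show ?case
  proof (cases "\<exists>u. (s, u) \<in> rstep D1")
    case True
    then obtain u where u: "(s, u) \<in> rstep D1" by blast
    then have "closed_tm u" using closed_rsteps_D1 less.prems by blast
    with u less.hyps weight_rstep_D1 show ?thesis
      by (meson converse_rtrancl_into_rtrancl)
  next
    case False
    with less.prems show ?thesis using irreducible_closed_canonical by blast
  qed
qed

lemma ground_confluent_D1: "ground_confluent D1"
  unfolding ground_confluent_def
proof (intro allI impI)
  fix s t u
  assume closed: "closed_tm t" "closed_tm u"
    and steps: "(s, t) \<in> (rstep D1)\<^sup>*" "(s, u) \<in> (rstep D1)\<^sup>*"
  obtain v w where v: "(t, v) \<in> (rstep D1)\<^sup>*" "canonical v"
    and w: "(u, w) \<in> (rstep D1)\<^sup>*" "canonical w"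
    using closed closed_normalises_to_canonical by meson
  \<comment> \<open>Both carry the integer value of \<open>s\<close>, so \<open>v\<close> is a
    common reduct of \<open>t\<close> and \<open>u\<close>.\<close>
  have "v = w"
    using v(2) w(2)
    by (rule canonical_eqI) (use steps v(1) w(1) in \<open>simp add: int_value_rsteps_D1\<close>)
  with v w closed show "\<exists>v. closed_tm v \<and> (t, v) \<in> (rstep D1)\<^sup>* \<and> (u, v) \<in> (rstep D1)\<^sup>*"
    using closed_rsteps_D1 by blast
qed

theorem theorem2p1p2:
  shows "ground_complete D1"
  using strongly_terminating_D1 ground_confluent_D1 by (simp add: ground_complete_def)

end
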